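(* Let $A \in \mathbf{R}^{m \times n}$ have rank $r$ and compact singular value decomposition $A = U\Sigma V^T$, where $U = [u_1 \cdots u_r] \in \mathbf{R}^{m\times r}$ and $V = [v_1 \cdots v_r] \in \mathbf{R}^{n \times r}$ have orthonormal columns and $\Sigma = \mathrm{diag}(\sigma_1,\ldots,\sigma_r)$ with $\sigma_1 \ge \cdots \ge \sigma_r > 0$. Let $1 \le k \le r$ and $\gamma \ge 0$. Put $U_k = [u_1 \cdots u_k]$, $V_k = [v_1 \cdots v_k]$, and $\tilde\Sigma_k = \mathrm{diag}((\sigma_1-\gamma)_+, \ldots, (\sigma_k - \gamma)_+)$. Then $$X = U_k \tilde\Sigma_k^{1/2}, \qquad Y = \tilde\Sigma_k^{1/2} V_k^T$$ is a solution (global minimizer) of the problem $$\mbox{minimize} \quad \|A - XY\|_F^2 + \gamma\|X\|_F^2 + \gamma\|Y\|_F^2$$ over $X \in \mathbf{R}^{m\times k}$ and $Y \in \mathbf{R}^{k \times n}$.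
   Context: $\|\cdot\|_F$ is the Frobenius norm and $(a)_+ = \max(a,0)$. The square root of a nonnegative diagonal matrix is taken entrywise on the diagonal. *)

theory Defs
  imports Complex_Main "Jordan_Normal_Form.DL_Rank"
begin

definition frobenius_norm :: "real mat \<Rightarrow> real" where
  "frobenius_norm M = sqrt (\<Sum>i<dim_row M. \<Sum>j<dim_col M. (M $$ (i, j))\<^sup>2)"

definition orthonormal_cols :: "real mat \<Rightarrow> bool" where
  "orthonormal_cols Q \<longleftrightarrow>
     (\<forall>i<dim_col Q. \<forall>j<dim_col Q. col Q i \<bullet> col Q j = (if i = j then 1 else 0))"

(* Indices start at 0: the singular values sigma_1, ..., sigma_r of the mathematical
   text are s 0, ..., s (r - 1); values of s outside this range are irrelevant. *)
definition compact_svd ::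
  "nat \<Rightarrow> nat \<Rightarrow> nat \<Rightarrow> real mat \<Rightarrow> real mat \<Rightarrow> (nat \<Rightarrow> real) \<Rightarrow> real mat \<Rightarrow> bool" where
  "compact_svd m n r A U s V \<longleftrightarrow>
     U \<in> carrier_mat m r \<and> orthonormal_cols U \<and>
     V \<in> carrier_mat n r \<and> orthonormal_cols V \<and>
     (\<forall>i j. i \<le> j \<and> j < r \<longrightarrow> s j \<le> s i) \<and> (\<forall>i<r. 0 < s i) \<and>
     A = U * mat_diag r s * transpose_mat V"

definition first_cols :: "nat \<Rightarrow> real mat \<Rightarrow> real mat" where
  "first_cols k M = mat_of_cols (dim_row M) (take k (cols M))"

definition thresholded_diag :: "nat \<Rightarrow> real \<Rightarrow> (nat \<Rightarrow> real) \<Rightarrow> real mat" where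
  "thresholded_diag k \<gamma> s = mat_diag k (\<lambda>i. max (s i - \<gamma>) 0)"

(* Only meant for square diagonal matrices with nonnegative entries. *)
definition diag_sqrt :: "real mat \<Rightarrow> real mat" where
  "diag_sqrt D = mat_diag (dim_row D) (\<lambda>i. sqrt (D $$ (i, i)))"

definition factorization_objective :: "real mat \<Rightarrow> real \<Rightarrow> real mat \<Rightarrow> real mat \<Rightarrow> real" where
  "factorization_objective A \<gamma> X Y =
     (frobenius_norm (A - X * Y))\<^sup>2 + \<gamma> * (frobenius_norm X)\<^sup>2 + \<gamma> * (frobenius_norm Y)\<^sup>2"

end

(* With d_t = (s_t - gamma)_+ one has s_t b <= d_t b + gamma |b| for every real b. For
   b_t = u_t^T X Y v_t, Bessel's inequality bounds 2 gamma sum_t |b_t| by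
   gamma (|X|_F^2 + |Y|_F^2), so that 2 <A, XY> is at most this penalty plus 2 sum_t d_t b_t.
   The last term is the inner product of the thresholded matrix sum_t d_t u_t v_t^T with the matrix
   XY of rank at most k; by the Eckart-Young argument it is at most
   |XY|_F^2 + d_1^2 + ... + d_k^2. Hence the objective is at least
   sum_t s_t^2 - (d_1^2 + ... + d_k^2), and the stated X, Y attain this value. *)
theory Submission
  imports Defs
begin

section \<open>Dot products of vectors encoded as functions\<close>

text \<open>Functions stand in for vectors, so families are curried functions without dimension side
  conditions; only the values below \<open>m\<close> count.\<close>

definition dot :: "nat \<Rightarrow> (nat \<Rightarrow> real) \<Rightarrow> (nat \<Rightarrow> real) \<Rightarrow> real" where
  "dot m f g = (\<Sum>i<m. f i * g i)"

lemma dot_commute: "dot m f g = dot m g f"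
  by (simp add: dot_def mult.commute)

lemma dot_diff_left: "dot m (\<lambda>i. f i - g i) h = dot m f h - dot m g h"
  by (simp add: dot_def left_diff_distrib sum_subtractf)

lemma dot_diff_right: "dot m h (\<lambda>i. f i - g i) = dot m h f - dot m h g"
  by (simp add: dot_def right_diff_distrib sum_subtractf)

lemma dot_scale_left: "dot m (\<lambda>i. c * f i) g = c * dot m f g"
  by (simp add: dot_def sum_distrib_left mult.assoc)

lemma dot_scale_right: "dot m g (\<lambda>i. c * f i) = c * dot m g f"
  by (simp add: dot_def sum_distrib_left mult_ac)

lemma dot_sum_left: "dot m (\<lambda>i. \<Sum>l\<in>L. c l * q l i) z = (\<Sum>l\<in>L. c l * dot m (q l) z)"
  unfolding dot_def sum_distrib_right sum_distrib_left
  by (subst sum.swap) (simp add: mult.assoc)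

lemma dot_sum_right: "dot m z (\<lambda>i. \<Sum>l\<in>L. c l * q l i) = (\<Sum>l\<in>L. c l * dot m z (q l))"
  using dot_sum_left[of m c q L z] by (simp add: dot_commute)

lemma dot_self: "dot m f f = (\<Sum>i<m. (f i)\<^sup>2)"
  by (simp add: dot_def power2_eq_square)

lemma dot_self_nonneg: "0 \<le> dot m f f"
  by (simp add: dot_self sum_nonneg)

lemma dot_self_eq_0: "dot m f f = 0 \<Longrightarrow> dot m f g = 0"
  by (simp add: dot_self sum_nonneg_eq_0_iff dot_def)

section \<open>Bessel's inequality and Gram-Schmidt\<close>

text \<open>Zero vectors are allowed, so that Gram-Schmidt does not have to drop linearly dependent vectors.\<close>
definition suborthonormal :: "nat \<Rightarrow> nat \<Rightarrow> (nat \<Rightarrow> nat \<Rightarrow> real) \<Rightarrow> bool" where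
  "suborthonormal m p q \<longleftrightarrow> (\<forall>i<p. dot m (q i) (q i) \<in> {0, 1}) \<and>
     (\<forall>i<p. \<forall>j<p. i \<noteq> j \<longrightarrow> dot m (q i) (q j) = 0)"

text \<open>The combination is the orthogonal projection of \<open>z\<close> on the span of the
  \<open>q j\<close>; pairing it with \<open>q l\<close> leaves only the term
  \<open>j = l\<close>.\<close>

lemma suborthonormal_dot_comb:
  assumes "suborthonormal m p q" and l: "l < p"
  shows "dot m (q l) (\<lambda>i. \<Sum>j<p. dot m (q j) z * q j i) = dot m (q l) z"
proof -
  have "dot m (q l) (\<lambda>i. \<Sum>j<p. dot m (q j) z * q j i) = (\<Sum>j<p. dot m (q j) z * dot m (q l) (q j))"
    by (rule dot_sum_right)
  also have "\<dots> = (\<Sum>j<p. if j = l then dot m (q l) z * dot m (q l) (q l) else 0)"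
    using assms by (intro sum.cong) (auto simp: suborthonormal_def)
  also have "\<dots> = dot m (q l) z * dot m (q l) (q l)"
    using l by simp
  \<comment> \<open>Either \<open>q l\<close> has norm 1, or its norm is 0 and both sides
    vanish.\<close>
  also have "\<dots> = dot m (q l) z"
    using assms dot_self_eq_0[of m "q l" z] by (auto simp: suborthonormal_def)
  finally show ?thesis .
qed

text \<open>The projection \<open>w\<close> of \<open>z\<close> satisfies <w,z> = <w,w>, and this
  number is the sum of squares; expanding the nonnegative <z-w,z-w> gives the claim.\<close>

lemma bessel:
  assumes "suborthonormal m p q"
  shows "(\<Sum>l<p. (dot m (q l) z)\<^sup>2) \<le> dot m z z"
proof -
  define w where "w i = (\<Sum>j<p. dot m (q j) z * q j i)" for i
  have S: "dot m w y = (\<Sum>l<p. dot m (q l) z * dot m (q l) y)" for y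
    unfolding w_def[abs_def] by (rule dot_sum_left)
  have wz: "dot m w z = (\<Sum>l<p. (dot m (q l) z)\<^sup>2)"
    by (simp add: S power2_eq_square)
  have ww: "dot m w w = (\<Sum>l<p. (dot m (q l) z)\<^sup>2)"
    using suborthonormal_dot_comb[OF assms, of _ z]
    by (simp add: S power2_eq_square flip: w_def)
  have "0 \<le> dot m (\<lambda>i. z i - w i) (\<lambda>i. z i - w i)"
    by (rule dot_self_nonneg)
  then show ?thesis
    using wz ww by (simp add: dot_diff_left dot_diff_right dot_commute[of m z w])
qed

text \<open>That \<open>x j\<close> lies in the span of the \<open>q l\<close> is expressed by
  pairing its expansion with an arbitrary \<open>z\<close>. This is the form used later, and it does
  not speak of values from \<open>m\<close> on.\<close>

lemma gram_schmidt_exists: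
  "\<exists>q. suborthonormal m k q \<and>
     (\<forall>j<k. \<forall>z. dot m (x j) z = (\<Sum>l<k. dot m (q l) (x j) * dot m (q l) z))"
proof (induction k)
  case 0
  show ?case by (simp add: suborthonormal_def)
next
  case (Suc k)
  then obtain q where q: "suborthonormal m k q"
    and span: "\<And>j z. j < k \<Longrightarrow> dot m (x j) z = (\<Sum>l<k. dot m (q l) (x j) * dot m (q l) z)"
    by blast
  define w where "w i = x k i - (\<Sum>l<k. dot m (q l) (x k) * q l i)" for i
  \<comment> \<open>If \<open>w\<close> has norm 0, division by zero makes \<open>c = 0\<close>, so
    the new vector is zero, as \<open>suborthonormal\<close> permits.\<close>
  define c where "c = 1 / sqrt (dot m w w)"
  define Q where "Q = q(k := (\<lambda>i. c * w i))"
  have Qk: "dot m (Q k) z = c * dot m w z" "dot m z (Q k) = c * dot m w z" for z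
    by (simp_all add: Q_def dot_scale_left dot_scale_right dot_commute[of m z])
  have Ql: "Q l = q l" if "l < k" for l
    using that by (simp add: Q_def)
  have ortho: "dot m (q l) w = 0" "dot m w (q l) = 0" if "l < k" for l
    using suborthonormal_dot_comb[OF q that, of "x k"]
    by (simp_all add: w_def[abs_def] dot_diff_right dot_diff_left dot_commute[of m _ "q l"])
  have wz: "dot m w z = dot m (x k) z - (\<Sum>l<k. dot m (q l) (x k) * dot m (q l) z)" for z
    by (simp add: w_def[abs_def] dot_diff_left dot_sum_left)
  \<comment> \<open>\<open>x k\<close> and \<open>w\<close> differ by a combination of the
    \<open>q l\<close>, to which \<open>w\<close> is orthogonal.\<close>
  have wx: "dot m w (x k) = dot m w w"
    using wz[of w] by (simp add: ortho dot_commute)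
  have cc: "c * c * dot m w w = 1" if "dot m w w \<noteq> 0"
    using that dot_self_nonneg[of m w] by (simp add: c_def)
  have "suborthonormal m (Suc k) Q"
    unfolding suborthonormal_def
  proof (intro conjI allI impI)
    fix i assume "i < Suc k"
    then consider "i < k" | "i = k" by linarith
    then show "dot m (Q i) (Q i) \<in> {0, 1}"
      by cases (use q cc in \<open>auto simp: Ql Qk suborthonormal_def mult.assoc\<close>)
  next
    fix i j assume "i < Suc k" "j < Suc k" "i \<noteq> j"
    then consider "i < k" "j < k" | "i = k" "j < k" | "i < k" "j = k" by linarith
    then show "dot m (Q i) (Q j) = 0"
      by cases (use q \<open>i \<noteq> j\<close> in \<open>auto simp: Ql Qk suborthonormal_def ortho\<close>)
  qed
  moreover have "dot m (x j) z = (\<Sum>l<Suc k. dot m (Q l) (x j) * dot m (Q l) z)" if "j < Suc k" for j z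
  proof -
    have sum_Q: "(\<Sum>l<Suc k. dot m (Q l) (x j) * dot m (Q l) z) =
        (\<Sum>l<k. dot m (q l) (x j) * dot m (q l) z) + c * c * dot m w (x j) * dot m w z"
      by (simp add: Ql Qk)
    show ?thesis
    proof (cases "j = k")
      case False
      \<comment> \<open>An earlier \<open>x j\<close> is spanned by the old \<open>q l\<close>, so
        the new summand vanishes.\<close>
      then have "dot m w (x j) = 0"
        using span[of j w] that by (simp add: ortho dot_commute[of m w])
      then show ?thesis using False that sum_Q span by simp
    next
      case True
      have w_part: "c * c * dot m w (x j) * dot m w z = dot m w z"
        using cc dot_self_eq_0[of m w z] by (cases "dot m w w = 0") (simp_all add: True wx)
      show ?thesis
        unfolding sum_Q w_part using wz[of z] by (simp add: True)
    qed
  qed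
  ultimately show ?case by blast
qed

section \<open>The Eckart-Young bound\<close>

text \<open>Weights in [0,1] of total at most \<open>k\<close> do best by putting weight 1 on the
  \<open>k\<close> largest values. The pivot \<open>d (k - 1)\<close> separates these from the
  rest.\<close>

lemma weighted_sum_le_top_sum:
  fixes c d :: "nat \<Rightarrow> real"
  assumes "1 \<le> k" "k \<le> r"
    and c: "\<And>t. t < r \<Longrightarrow> 0 \<le> c t" "\<And>t. t < r \<Longrightarrow> c t \<le> 1" and ck: "(\<Sum>t<r. c t) \<le> real k"
    and d: "\<And>t. t < r \<Longrightarrow> 0 \<le> d t" "\<And>i j. i \<le> j \<Longrightarrow> j < r \<Longrightarrow> d j \<le> d i"
  shows "(\<Sum>t<r. c t * d t) \<le> (\<Sum>t<k. d t)"
proof -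
  define e where "e t = (if t < k then 1 else 0 :: real)" for t
  have sum_e: "(\<Sum>t<r. e t * f t) = (\<Sum>t<k. f t)" for f
  proof -
    have "(\<Sum>t<k. f t) = (\<Sum>t<k. e t * f t)" by (simp add: e_def)
    also have "\<dots> = (\<Sum>t<r. e t * f t)"
      using \<open>k \<le> r\<close> by (intro sum.mono_neutral_left) (auto simp: e_def)
    finally show ?thesis by simp
  qed
  \<comment> \<open>For \<open>t < k\<close> the factor \<open>c t - e t\<close> is at most 0 and
    \<open>d t\<close> is at least the pivot; for later \<open>t\<close> both comparisons are
    reversed.\<close>
  have "(\<Sum>t<r. (c t - e t) * d t) \<le> (\<Sum>t<r. (c t - e t) * d (k - 1))"
  proof (rule sum_mono)
    fix t assume "t \<in> {..<r}"
    then have t: "t < r" by simp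
    show "(c t - e t) * d t \<le> (c t - e t) * d (k - 1)"
    proof (cases "t < k")
      case True
      then have "d (k - 1) \<le> d t" using d(2)[of t "k - 1"] assms(1,2) by simp
      then show ?thesis using True c(2)[OF t] by (simp add: e_def mult_left_mono_neg)
    next
      case False
      then have "d t \<le> d (k - 1)" using d(2)[of "k - 1" t] t by simp
      then show ?thesis using False c(1)[OF t] by (simp add: e_def mult_left_mono)
    qed
  qed
  also have "\<dots> = ((\<Sum>t<r. c t) - real k) * d (k - 1)"
    using sum_e[of "\<lambda>_. 1"] by (simp add: sum_subtractf flip: sum_distrib_right)
  also have "\<dots> \<le> 0"
    using ck d(1)[of "k - 1"] assms(1,2) by (intro mult_nonpos_nonneg) auto
  finally show ?thesis
    by (simp add: left_diff_distrib sum_subtractf sum_e)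
qed

lemma suborthonormal_self_le_1: "suborthonormal m p q \<Longrightarrow> l < p \<Longrightarrow> dot m (q l) (q l) \<le> 1"
  by (auto simp: suborthonormal_def)

lemma two_mult_le_sum_squares: "2 * (a * b) \<le> a\<^sup>2 + (b::real)\<^sup>2"
  using sum_squares_bound[of a b] by simp

text \<open>In effect the Eckart-Young bound: projecting on the span of the columns of a rank \<open>k\<close> matrix
  \<open>B\<close> gives \<open>2 \<langle>D, B\<rangle> \<le> \<parallel>P D\<parallel>\<^sup>2 + \<parallel>B\<parallel>\<^sup>2\<close>, where \<open>D = \<Sum>t. d t u\<^sub>t v\<^sub>t\<^sup>T\<close>.\<close>
lemma inner_rank_k_le:
  fixes x y u v :: "nat \<Rightarrow> nat \<Rightarrow> real"
  assumes u: "suborthonormal m r u" and v: "suborthonormal n r v"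
    and k: "1 \<le> k" "k \<le> r"
    and d: "\<And>t. t < r \<Longrightarrow> 0 \<le> d t" "\<And>i j. i \<le> j \<Longrightarrow> j < r \<Longrightarrow> d j \<le> d i"
  shows "2 * (\<Sum>t<r. d t * (\<Sum>j<k. dot m (x j) (u t) * dot n (y j) (v t)))
    \<le> (\<Sum>i<m. \<Sum>l<n. (\<Sum>j<k. x j i * y j l)\<^sup>2) + (\<Sum>t<k. (d t)\<^sup>2)"
proof -
  obtain q where q: "suborthonormal m k q"
    and span: "\<And>j z. j < k \<Longrightarrow> dot m (x j) z = (\<Sum>p<k. dot m (q p) (x j) * dot m (q p) z)"
    using gram_schmidt_exists[of m k x] by blast
  \<comment> \<open>With B the matrix whose entries are the sums of \<open>x j i * y j l\<close>,
    \<open>g p\<close> is the row q_p^T B. Since the columns of B lie in the span of the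
    \<open>q p\<close>, B = sum_p q_p g_p^T.\<close>
  define g where "g p l = (\<Sum>j<k. dot m (q p) (x j) * y j l)" for p l
  have g_dot: "dot n (g p) z = (\<Sum>j<k. dot m (q p) (x j) * dot n (y j) z)" for p z
    unfolding g_def[abs_def] by (rule dot_sum_left)
  have inner: "(\<Sum>j<k. dot m (x j) z * dot n (y j) z') = (\<Sum>p<k. dot m (q p) z * dot n (g p) z')" for z z'
  proof -
    have "(\<Sum>j<k. dot m (x j) z * dot n (y j) z')
        = (\<Sum>j<k. \<Sum>p<k. dot m (q p) (x j) * dot m (q p) z * dot n (y j) z')"
      by (simp add: span sum_distrib_right)
    also have "\<dots> = (\<Sum>p<k. \<Sum>j<k. dot m (q p) (x j) * dot m (q p) z * dot n (y j) z')"
      by (rule sum.swap)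
    finally show ?thesis by (simp add: g_dot sum_distrib_left mult_ac)
  qed
  have norm: "(\<Sum>i<m. \<Sum>l<n. (\<Sum>j<k. x j i * y j l)\<^sup>2) = (\<Sum>p<k. dot n (g p) (g p))"
  proof -
    \<comment> \<open>Parseval's identity for \<open>b\<close>, the column of B with index
      \<open>l\<close>.\<close>
    have col: "(\<Sum>i<m. (\<Sum>j<k. x j i * y j l)\<^sup>2) = (\<Sum>p<k. (g p l)\<^sup>2)" for l
    proof -
      define b where "b i = (\<Sum>j<k. y j l * x j i)" for i
      have b_dot: "dot m b z = (\<Sum>j<k. y j l * dot m (x j) z)" for z
        unfolding b_def[abs_def] by (rule dot_sum_left)
      have gb: "dot m (q p) b = g p l" for p
        by (simp add: dot_commute[of m "q p" b] b_dot g_def dot_commute[of m "q p"] mult.commute)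
      have "dot m b b = (\<Sum>j<k. \<Sum>p<k. y j l * (dot m (q p) (x j) * g p l))"
        by (simp add: b_dot[of b] span gb sum_distrib_left)
      also have "\<dots> = (\<Sum>p<k. \<Sum>j<k. y j l * (dot m (q p) (x j) * g p l))"
        by (rule sum.swap)
      also have "\<dots> = (\<Sum>p<k. (g p l)\<^sup>2)"
        by (simp add: g_def power2_eq_square sum_distrib_right mult_ac)
      finally show ?thesis by (simp add: dot_self b_def mult.commute)
    qed
    show ?thesis
      by (subst sum.swap) (simp add: col dot_self sum.swap[of _ "{..<n}"])
  qed
  \<comment> \<open>The squared length of the projection of \<open>u t\<close> on the span of the
    \<open>q p\<close>.\<close>
  define c where "c t = (\<Sum>p<k. (dot m (q p) (u t))\<^sup>2)" for t
  have "2 * (\<Sum>t<r. d t * (\<Sum>p<k. dot m (q p) (u t) * dot n (g p) (v t)))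
      = (\<Sum>t<r. \<Sum>p<k. 2 * ((d t * dot m (q p) (u t)) * dot n (g p) (v t)))"
    by (simp add: sum_distrib_left mult_ac)
  \<comment> \<open>The factor \<open>d t\<close> stays with the \<open>q p\<close> part, so that
    the other squares can be summed over \<open>t\<close> by Bessel's inequality for
    \<open>v\<close>.\<close>
  also have "\<dots> \<le> (\<Sum>t<r. \<Sum>p<k. (d t * dot m (q p) (u t))\<^sup>2 + (dot n (g p) (v t))\<^sup>2)"
    by (intro sum_mono two_mult_le_sum_squares)
  also have "\<dots> = (\<Sum>t<r. c t * (d t)\<^sup>2) + (\<Sum>p<k. \<Sum>t<r. (dot n (g p) (v t))\<^sup>2)"
    by (simp add: sum.distrib c_def power_mult_distrib sum_distrib_left mult.commute
        sum.swap[of _ "{..<r}" "{..<k}"])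
  also have "(\<Sum>p<k. \<Sum>t<r. (dot n (g p) (v t))\<^sup>2) \<le> (\<Sum>p<k. dot n (g p) (g p))"
    using bessel[OF v] by (intro sum_mono) (simp add: dot_commute[of n "v _"])
  also have "(\<Sum>t<r. c t * (d t)\<^sup>2) \<le> (\<Sum>t<k. (d t)\<^sup>2)"
  proof (rule weighted_sum_le_top_sum[OF k])
    show "0 \<le> c t" for t by (simp add: c_def sum_nonneg)
    show "c t \<le> 1" if "t < r" for t
      using bessel[OF q, of "u t"] suborthonormal_self_le_1[OF u that] by (simp add: c_def)
    \<comment> \<open>After swapping the sums, Bessel's inequality for \<open>u\<close> bounds the
      contribution of each \<open>q p\<close> by its squared norm, at most 1.\<close>
    have "(\<Sum>t<r. c t) = (\<Sum>p<k. \<Sum>t<r. (dot m (u t) (q p))\<^sup>2)"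
      unfolding c_def by (subst sum.swap) (simp add: dot_commute[of m "q _"])
    also have "\<dots> \<le> (\<Sum>p<k. 1)"
      using bessel[OF u] suborthonormal_self_le_1[OF q] by (intro sum_mono) (meson lessThan_iff order_trans)
    finally show "(\<Sum>t<r. c t) \<le> real k" by simp
    show "(d j)\<^sup>2 \<le> (d i)\<^sup>2" if "i \<le> j" "j < r" for i j
      using d that by (intro power_mono) auto
  qed simp
  finally show ?thesis by (simp add: inner norm)
qed

section \<open>Lower bound for the objective in coordinates\<close>

text \<open>The matrices u_t v_t^T are orthonormal for the Frobenius inner product. Summing over
  \<open>l\<close> first uses orthonormality of \<open>v\<close> to remove the cross terms; the sum
  over \<open>i\<close> then needs only the norms of the \<open>u t\<close>.\<close>

lemma sum_squares_rank_one_sum: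
  fixes u v :: "nat \<Rightarrow> nat \<Rightarrow> real"
  assumes u: "\<And>t t'. t < r \<Longrightarrow> t' < r \<Longrightarrow> dot m (u t) (u t') = (if t = t' then 1 else 0)"
    and v: "\<And>t t'. t < r \<Longrightarrow> t' < r \<Longrightarrow> dot n (v t) (v t') = (if t = t' then 1 else 0)"
  shows "(\<Sum>i<m. \<Sum>l<n. (\<Sum>t<r. c t * u t i * v t l)\<^sup>2) = (\<Sum>t<r. (c t)\<^sup>2)"
proof -
  have row: "(\<Sum>l<n. (\<Sum>t<r. c t * u t i * v t l)\<^sup>2) = (\<Sum>t<r. (c t * u t i)\<^sup>2)" for i
  proof -
    have "(\<Sum>l<n. (\<Sum>t<r. c t * u t i * v t l)\<^sup>2) = 
       dot n (\<lambda>l. \<Sum>t<r. c t * u t i * v t l) (\<lambda>l. \<Sum>t<r. c t * u t i * v t l)"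
      by (simp add: dot_self)
    also have "\<dots> = (\<Sum>t<r. \<Sum>t'<r. if t' = t then (c t * u t i)\<^sup>2 else 0)"
      unfolding dot_sum_left dot_sum_right sum_distrib_left
      by (intro sum.cong refl) (auto simp: v power2_eq_square)
    also have "\<dots> = (\<Sum>t<r. (c t * u t i)\<^sup>2)"
      by simp
    finally show ?thesis .
  qed
  have "(\<Sum>i<m. \<Sum>t<r. (c t * u t i)\<^sup>2) = (\<Sum>t<r. (c t)\<^sup>2 * dot m (u t) (u t))"
    by (subst sum.swap) (simp add: dot_self power_mult_distrib sum_distrib_left)
  then show ?thesis by (simp add: row u)
qed

text \<open>Bilinearity together with <u v^T, x y^T> = <x,u><y,v>; this evaluates the cross term of
  the squared residual.\<close>

lemma inner_rank_one_sum:
  fixes x y u v :: "nat \<Rightarrow> nat \<Rightarrow> real"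
  shows "(\<Sum>i<m. \<Sum>l<n. (\<Sum>t<r. s t * u t i * v t l) * (\<Sum>j<k. x j i * y j l))
   = (\<Sum>t<r. s t * (\<Sum>j<k. dot m (x j) (u t) * dot n (y j) (v t)))"
proof -
  have "(\<Sum>i<m. \<Sum>l<n. (\<Sum>t<r. s t * u t i * v t l) * (\<Sum>j<k. x j i * y j l))
     = (\<Sum>i<m. \<Sum>l<n. \<Sum>t<r. \<Sum>j<k. s t * (x j i * u t i) * (y j l * v t l))"
    unfolding sum_product by (simp add: mult_ac)
  also have "\<dots> = (\<Sum>i<m. \<Sum>t<r. \<Sum>j<k. \<Sum>l<n. s t * (x j i * u t i) * (y j l * v t l))"
    by (simp add: sum.swap[of _ _ "{..<n}"])
  also have "\<dots> = (\<Sum>t<r. \<Sum>j<k. \<Sum>i<m. \<Sum>l<n. s t * (x j i * u t i) * (y j l * v t l))"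
    by (simp add: sum.swap[of _ _ "{..<m}"])
  also have "\<dots> = (\<Sum>t<r. \<Sum>j<k. s t * (dot m (x j) (u t) * dot n (y j) (v t)))"
    unfolding dot_def sum_product unfolding sum_distrib_left by (simp add: mult_ac)
  finally show ?thesis
    by (simp add: sum_distrib_left)
qed

text \<open>Here \<open>x j\<close> plays the role of a column of X and \<open>y j\<close> of a row
  of Y. Expanding the square reduces the claim to an upper bound on twice the cross term.\<close>

lemma objective_lower_bound:
  fixes x y u v :: "nat \<Rightarrow> nat \<Rightarrow> real"
  assumes u: "\<And>t t'. t < r \<Longrightarrow> t' < r \<Longrightarrow> dot m (u t) (u t') = (if t = t' then 1 else 0)"
    and v: "\<And>t t'. t < r \<Longrightarrow> t' < r \<Longrightarrow> dot n (v t) (v t') = (if t = t' then 1 else 0)"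
    and k: "1 \<le> k" "k \<le> r" and \<gamma>: "0 \<le> \<gamma>"
    and s: "\<And>t. t < r \<Longrightarrow> 0 \<le> s t" "\<And>i j. i \<le> j \<Longrightarrow> j < r \<Longrightarrow> s j \<le> s i"
  shows "(\<Sum>t<r. (s t)\<^sup>2) - (\<Sum>t<k. (max (s t - \<gamma>) 0)\<^sup>2)
    \<le> (\<Sum>i<m. \<Sum>l<n. ((\<Sum>t<r. s t * u t i * v t l) - (\<Sum>j<k. x j i * y j l))\<^sup>2)
      + \<gamma> * (\<Sum>j<k. dot m (x j) (x j)) + \<gamma> * (\<Sum>j<k. dot n (y j) (y j))"
proof -
  have uu: "suborthonormal m r u" and vv: "suborthonormal n r v"
    using u v by (auto simp: suborthonormal_def)
  define d where "d t = max (s t - \<gamma>) 0" for t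
  define b where "b t = (\<Sum>j<k. dot m (x j) (u t) * dot n (y j) (v t))" for t
  define N where "N = (\<Sum>i<m. \<Sum>l<n. (\<Sum>j<k. x j i * y j l)\<^sup>2)"
  have "2 * (s t * b t) \<le> 2 * (d t * b t) + \<gamma> * (\<Sum>j<k. (dot m (u t) (x j))\<^sup>2 + (dot n (v t) (y j))\<^sup>2)"
    if t: "t < r" for t
  proof -
    have "2 * \<bar>b t\<bar> \<le> (\<Sum>j<k. 2 * (\<bar>dot m (u t) (x j)\<bar> * \<bar>dot n (v t) (y j)\<bar>))"
      unfolding b_def sum_distrib_left[symmetric]
      by (simp add: dot_commute[of m "u t"] dot_commute[of n "v t"] order.trans[OF sum_abs] flip: abs_mult)
    also have "\<dots> \<le> (\<Sum>j<k. (dot m (u t) (x j))\<^sup>2 + (dot n (v t) (y j))\<^sup>2)"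
      by (intro sum_mono order.trans[OF two_mult_le_sum_squares]) simp
    finally have b: "2 * \<bar>b t\<bar> \<le> \<dots>" .
    have "(s t - d t) * b t \<le> \<bar>s t - d t\<bar> * \<bar>b t\<bar>"
      by (simp flip: abs_mult)
    \<comment> \<open>\<open>s t - d t\<close> is the minimum of \<open>s t\<close> and
      \<open>\<gamma>\<close>, hence lies between 0 and \<open>\<gamma>\<close>.\<close>
    also have "\<dots> \<le> \<gamma> * \<bar>b t\<bar>"
      using s(1)[OF t] \<gamma> by (intro mult_right_mono) (auto simp: d_def)
    finally show ?thesis
      using mult_left_mono[OF b \<gamma>] by (simp add: algebra_simps)
  qed
  then have "2 * (\<Sum>t<r. s t * b t) \<le> (\<Sum>t<r. 2 * (d t * b t)
      + \<gamma> * (\<Sum>j<k. (dot m (u t) (x j))\<^sup>2 + (dot n (v t) (y j))\<^sup>2))"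
    unfolding sum_distrib_left by (intro sum_mono) auto
  also have "\<dots> = 2 * (\<Sum>t<r. d t * b t)
      + \<gamma> * (\<Sum>j<k. (\<Sum>t<r. (dot m (u t) (x j))\<^sup>2) + (\<Sum>t<r. (dot n (v t) (y j))\<^sup>2))"
    by (simp add: sum.distrib sum.swap[of _ "{..<r}" "{..<k}"] flip: sum_distrib_left)
  also have "\<dots> \<le> (N + (\<Sum>t<k. (d t)\<^sup>2)) + \<gamma> * (\<Sum>j<k. dot m (x j) (x j) + dot n (y j) (y j))"
  proof (intro add_mono mult_left_mono sum_mono \<gamma> bessel[OF uu] bessel[OF vv])
    show "2 * (\<Sum>t<r. d t * b t) \<le> N + (\<Sum>t<k. (d t)\<^sup>2)"
      unfolding b_def N_def
      by (rule inner_rank_k_le[OF uu vv k]) (use s(2) in \<open>force simp: d_def\<close>)+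
  qed
  finally have main: "2 * (\<Sum>t<r. s t * b t) \<le> \<dots>" .
  have normA: "(\<Sum>i<m. \<Sum>l<n. (\<Sum>t<r. s t * u t i * v t l)\<^sup>2) = (\<Sum>t<r. (s t)\<^sup>2)"
    by (rule sum_squares_rank_one_sum) (use u v in auto)
  have "(\<Sum>i<m. \<Sum>l<n. ((\<Sum>t<r. s t * u t i * v t l) - (\<Sum>j<k. x j i * y j l))\<^sup>2)
      = (\<Sum>t<r. (s t)\<^sup>2) + N - 2 * (\<Sum>t<r. s t * b t)"
    unfolding power2_diff sum.distrib sum_subtractf b_def N_def normA
    by (simp add: mult.assoc
        flip: inner_rank_one_sum sum_distrib_left)
  then show ?thesis
    using main unfolding d_def by (simp add: sum.distrib algebra_simps)
qed

section \<open>Translation from matrices to coordinates\<close>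

lemma frobenius_norm_squared:
  assumes "M \<in> carrier_mat m n"
  shows "(frobenius_norm M)\<^sup>2 = (\<Sum>i<m. \<Sum>j<n. (M $$ (i, j))\<^sup>2)"
  using assms by (simp add: frobenius_norm_def sum_nonneg)

lemma index_mult_mat_sum:
  assumes "X \<in> carrier_mat m k" "Y \<in> carrier_mat k n" "i < m" "l < n"
  shows "(X * Y) $$ (i, l) = (\<Sum>j<k. X $$ (i, j) * Y $$ (j, l))"
  using assms by (simp add: scalar_prod_def atLeast0LessThan)

lemma orthonormal_cols_dot:
  assumes "Q \<in> carrier_mat m r" "orthonormal_cols Q" "t < r" "t' < r"
  shows "dot m (\<lambda>i. Q $$ (i, t)) (\<lambda>i. Q $$ (i, t')) = (if t = t' then 1 else 0)"
  using assms by (auto simp: orthonormal_cols_def scalar_prod_def atLeast0LessThan dot_def)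

lemma first_cols_carrier:
  assumes "Q \<in> carrier_mat m r" "k \<le> r"
  shows "first_cols k Q \<in> carrier_mat m k"
  using assms by (intro carrier_matI) (auto simp: first_cols_def)

lemma index_first_cols:
  assumes "Q \<in> carrier_mat m r" "k \<le> r" "i < m" "j < k"
  shows "first_cols k Q $$ (i, j) = Q $$ (i, j)"
  using assms by (simp add: first_cols_def mat_of_cols_index)

lemma diag_sqrt_thresholded_diag:
  "diag_sqrt (thresholded_diag k \<gamma> s) = mat_diag k (\<lambda>i. sqrt (max (s i - \<gamma>) 0))"
  by (rule eq_matI) (auto simp: diag_sqrt_def thresholded_diag_def mat_diag_def)

lemma index_compact_svd:
  assumes "compact_svd m n r A U s V" "i < m" "l < n"
  shows "A $$ (i, l) = (\<Sum>t<r. s t * U $$ (i, t) * V $$ (l, t))"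
proof -
  have U: "U \<in> carrier_mat m r" and V: "V \<in> carrier_mat n r"
    and A: "A = U * mat_diag r s * transpose_mat V"
    using assms by (auto simp: compact_svd_def)
  show ?thesis
    unfolding A mat_diag_mult_right[OF U]
    by (subst index_mult_mat_sum[of _ m r _ n]) (use assms U V in \<open>auto simp: mult_ac\<close>)
qed

section \<open>Attainment of the bound\<close>

theorem mainTheorem1:
  fixes A U V :: "real mat" and s :: "nat \<Rightarrow> real" and \<gamma> :: real and m n r k :: nat
  assumes "A \<in> carrier_mat m n"
    and "vec_space.rank m A = r"
    and "compact_svd m n r A U s V"
    and "1 \<le> k" and "k \<le> r"
    and "0 \<le> \<gamma>"
  shows "is_arg_min
    (\<lambda>(X, Y). factorization_objective A \<gamma> X Y)
    (\<lambda>(X, Y). X \<in> carrier_mat m k \<and> Y \<in> carrier_mat k n)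
    (first_cols k U * diag_sqrt (thresholded_diag k \<gamma> s),
     diag_sqrt (thresholded_diag k \<gamma> s) * transpose_mat (first_cols k V))"
proof -
  define d where "d t = max (s t - \<gamma>) 0" for t
  define X0 where "X0 = first_cols k U * diag_sqrt (thresholded_diag k \<gamma> s)"
  define Y0 where "Y0 = diag_sqrt (thresholded_diag k \<gamma> s) * transpose_mat (first_cols k V)"
  define u where "u t i = U $$ (i, t)" for t i
  define v where "v t i = V $$ (i, t)" for t i
  note svd = \<open>compact_svd m n r A U s V\<close>
  have U: "U \<in> carrier_mat m r" "orthonormal_cols U" and V: "V \<in> carrier_mat n r" "orthonormal_cols V"
    and s: "\<And>i j. i \<le> j \<Longrightarrow> j < r \<Longrightarrow> s j \<le> s i" "\<And>t. t < r \<Longrightarrow> 0 \<le> s t"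
    using svd by (auto simp: compact_svd_def intro: less_imp_le)
  have uu: "dot m (u t) (u t') = (if t = t' then 1 else 0)" if "t < r" "t' < r" for t t'
    using orthonormal_cols_dot[OF U that] by (simp add: u_def[abs_def])
  have vv: "dot n (v t) (v t') = (if t = t' then 1 else 0)" if "t < r" "t' < r" for t t'
    using orthonormal_cols_dot[OF V that] by (simp add: v_def[abs_def])
  have A: "A $$ (i, l) = (\<Sum>t<r. s t * u t i * v t l)" if "i < m" "l < n" for i l
    using index_compact_svd[OF svd that] by (simp add: u_def v_def)
  have objective: "factorization_objective A \<gamma> X Y =
      (\<Sum>i<m. \<Sum>l<n. ((\<Sum>t<r. s t * u t i * v t l) - (\<Sum>j<k. X $$ (i, j) * Y $$ (j, l)))\<^sup>2)
      + \<gamma> * (\<Sum>j<k. dot m (\<lambda>i. X $$ (i, j)) (\<lambda>i. X $$ (i, j)))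
      + \<gamma> * (\<Sum>j<k. dot n (\<lambda>l. Y $$ (j, l)) (\<lambda>l. Y $$ (j, l)))"
    if X: "X \<in> carrier_mat m k" and Y: "Y \<in> carrier_mat k n" for X Y
  proof -
    have XY: "X * Y \<in> carrier_mat m n" using X Y by simp
    have "(frobenius_norm (A - X * Y))\<^sup>2 = (\<Sum>i<m. \<Sum>l<n. ((A - X * Y) $$ (i, l))\<^sup>2)"
      by (rule frobenius_norm_squared[OF minus_carrier_mat[OF XY]])
    also have "\<dots> = (\<Sum>i<m. \<Sum>l<n. ((\<Sum>t<r. s t * u t i * v t l) - (\<Sum>j<k. X $$ (i, j) * Y $$ (j, l)))\<^sup>2)"
      using X Y by (intro sum.cong refl) (simp add: A flip: index_mult_mat_sum[OF X Y])
    finally show ?thesis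
      unfolding factorization_objective_def frobenius_norm_squared[OF X] frobenius_norm_squared[OF Y]
      by (simp add: dot_self sum.swap[of _ "{..<m}"])
  qed
  have FU: "first_cols k U \<in> carrier_mat m k" and FV: "transpose_mat (first_cols k V) \<in> carrier_mat k n"
    using first_cols_carrier[OF U(1) \<open>k \<le> r\<close>] first_cols_carrier[OF V(1) \<open>k \<le> r\<close>] by auto
  have X0: "X0 \<in> carrier_mat m k" and Y0: "Y0 \<in> carrier_mat k n"
    unfolding X0_def Y0_def diag_sqrt_thresholded_diag
    by (rule mult_carrier_mat[OF FU] mult_carrier_mat[OF _ FV]; simp)+
  have X0_index: "X0 $$ (i, j) = sqrt (d j) * u j i" if "i < m" "j < k" for i j
    using that index_first_cols[OF U(1) \<open>k \<le> r\<close> that]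
    by (simp add: X0_def diag_sqrt_thresholded_diag mat_diag_mult_right[OF FU] d_def u_def mult.commute)
  have Y0_index: "Y0 $$ (j, l) = sqrt (d j) * v j l" if "l < n" "j < k" for j l
    using that index_first_cols[OF V(1) \<open>k \<le> r\<close> that] FV
    by (simp add: Y0_def diag_sqrt_thresholded_diag mat_diag_mult_left[OF FV] d_def v_def)
  have d0: "0 \<le> d t" for t by (simp add: d_def)
  \<comment> \<open>Padding the thresholded values with zeros up to \<open>r\<close> writes the
    product \<open>X0 * Y0\<close> over the same index range as the singular value decomposition of
    \<open>A\<close>.\<close>
  define e where "e t = (if t < k then d t else 0)" for t
  have pad: "(\<Sum>t<k. f (d t) t) = (\<Sum>t<r. f (e t) t)" if "\<And>t. f 0 t = 0" for f :: "real \<Rightarrow> nat \<Rightarrow> real"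
    using \<open>k \<le> r\<close> by (intro sum.mono_neutral_cong_left) (auto simp: e_def that)
  have dotX0: "dot m (\<lambda>i. X0 $$ (i, j)) (\<lambda>i. X0 $$ (i, j)) = d j" if "j < k" for j
  proof -
    have "dot m (\<lambda>i. X0 $$ (i, j)) (\<lambda>i. X0 $$ (i, j)) = dot m (\<lambda>i. sqrt (d j) * u j i) (\<lambda>i. sqrt (d j) * u j i)"
      using that by (simp add: dot_def X0_index)
    then show ?thesis using that \<open>k \<le> r\<close> by (simp add: dot_scale_left dot_scale_right uu d0)
  qed
  have dotY0: "dot n (\<lambda>l. Y0 $$ (j, l)) (\<lambda>l. Y0 $$ (j, l)) = d j" if "j < k" for j
  proof -
    have "dot n (\<lambda>l. Y0 $$ (j, l)) (\<lambda>l. Y0 $$ (j, l)) = dot n (\<lambda>l. sqrt (d j) * v j l) (\<lambda>l. sqrt (d j) * v j l)"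
      using that by (simp add: dot_def Y0_index)
    then show ?thesis using that \<open>k \<le> r\<close> by (simp add: dot_scale_left dot_scale_right vv d0)
  qed
  \<comment> \<open>\<open>A\<close> and \<open>X0 * Y0\<close> share their singular vectors, so the
    residual has coefficients \<open>s t - e t\<close> and its norm follows from
    orthonormality.\<close>
  have residual: "(\<Sum>t<r. s t * u t i * v t l) - (\<Sum>j<k. X0 $$ (i, j) * Y0 $$ (j, l))
      = (\<Sum>t<r. (s t - e t) * u t i * v t l)" if "i < m" "l < n" for i l
  proof -
    have "X0 $$ (i, j) * Y0 $$ (j, l) = d j * u j i * v j l" if "j < k" for j
      using that \<open>i < m\<close> \<open>l < n\<close> d0[of j] real_sqrt_mult_self[of "d j"] by (simp add: X0_index Y0_index)
    then have "(\<Sum>j<k. X0 $$ (i, j) * Y0 $$ (j, l)) = (\<Sum>j<k. d j * u j i * v j l)"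
      by simp
    also have "\<dots> = (\<Sum>j<r. e j * u j i * v j l)"
      by (rule pad[of "\<lambda>c j. c * u j i * v j l"]) simp
    finally show ?thesis
      by (simp add: left_diff_distrib sum_subtractf)
  qed
  \<comment> \<open>Splitting \<open>d j\<close> evenly by square roots makes the penalties of
    \<open>X0\<close> and \<open>Y0\<close> equal, hence the factor 2.\<close>
  have "factorization_objective A \<gamma> X0 Y0 = (\<Sum>t<r. (s t - e t)\<^sup>2) + 2 * \<gamma> * (\<Sum>j<k. d j)"
    unfolding objective[OF X0 Y0]
    by (simp add: residual dotX0 dotY0 sum_squares_rank_one_sum[OF uu vv])
  also have "(\<Sum>j<k. d j) = (\<Sum>t<r. e t)"
    by (rule pad[of "\<lambda>c _. c"]) simp
  \<comment> \<open>Termwise: where \<open>e t\<close> is nonzero,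
    \<open>\<gamma> = s t - e t\<close>, and (s-e)^2 + 2(s-e)e = s^2 - e^2; where it is zero, both
    sides are s^2.\<close>
  also have "(\<Sum>t<r. (s t - e t)\<^sup>2) + 2 * \<gamma> * (\<Sum>t<r. e t) = (\<Sum>t<r. (s t)\<^sup>2 - (e t)\<^sup>2)"
    unfolding sum_distrib_left sum.distrib[symmetric]
    by (intro sum.cong refl) (auto simp: e_def d_def max_def power2_eq_square algebra_simps)
  also have "\<dots> = (\<Sum>t<r. (s t)\<^sup>2) - (\<Sum>t<k. (d t)\<^sup>2)"
    using pad[of "\<lambda>c _. c\<^sup>2"] by (simp add: sum_subtractf)
  finally have opt: "factorization_objective A \<gamma> X0 Y0 = \<dots>" .
  have "factorization_objective A \<gamma> X0 Y0 \<le> factorization_objective A \<gamma> X Y"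
    if "X \<in> carrier_mat m k" "Y \<in> carrier_mat k n" for X Y
    unfolding opt objective[OF that] d_def
    by (rule objective_lower_bound[OF uu vv \<open>1 \<le> k\<close> \<open>k \<le> r\<close> \<open>0 \<le> \<gamma>\<close>]) (use s in auto)
  then show ?thesis
    using X0 Y0 unfolding X0_def Y0_def by (auto simp: is_arg_min_linorder)
qed

end
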